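(* Let $V\neq 0$ be a finite-dimensional complex vector space with a non-degenerate symmetric bilinear form $(-,-)$, and let $R\subset V$ be a subset which spans $V$ and satisfies the axioms (GR0), (GR2) and (WGR3). Then: (i) if $R$ is irreducible and contains an isotropic root (an element $\alpha\in R$ with $(\alpha,\alpha)=0$), then $R$ is finite; (ii) $R$ is a WGRS; that is, $R$ also satisfies (GR1).
   Context: Let $V$ be a finite-dimensional complex vector space with a symmetric bilinear form $(-,-)$, and $\mathrm{Ker}(-,-)=\{v\in V:\ (v,w)=0\ \forall w\in V\}$. For $\alpha\in V$ with $(\alpha,\alpha)\ne 0$ and $v\in V$ put $k_{\alpha,v}:=2(\alpha,v)/(\alpha,\alpha)$ and $r_\alpha(v):=v-k_{\alpha,v}\alpha$. For $X\subset V$, $\mathbb{Z}X$ is the additive subgroup generated by $X$. Axioms for a non-empty $R\subset V$: (GR0) $\mathrm{Ker}(-,-)\cap R=\emptyset$. (GR1) The canonical map $\mathbb{Z}R\otimes_{\mathbb{Z}}\mathbb{C}\to V$ is a bijection. (GR2) For each $\alpha\in R$ with $(\alpha,\alpha)\neq 0$ one has $r_\alpha R=R$, and $\beta-r_\alpha\beta\in\mathbb{Z}\alpha$ for each $\beta\in R$. (WGR3) For each $\alpha\in R$ with $(\alpha,\alpha)=0$ there exists a map $r_\alpha:R\to R$ such that $r_\alpha(\alpha)=-\alpha$, $r_\alpha(-\alpha)=\alpha$; $r_\alpha(\beta)=\beta$ if $\beta\ne\pm\alpha$ and $(\alpha,\beta)=0$; $r_\alpha(\beta)\in\{\beta+\alpha,\beta-\alpha\}$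 if $(\alpha,\beta)\neq 0$. A WGRS (weak GRS) in a space $V$ with non-degenerate form is a subset $R\subset V$ satisfying (GR0), (GR1), (GR2), (WGR3). A set $R$ satisfying (GR0), (GR2), (WGR3) is irreducible if it is not of the form $R=R_1\coprod R_2$ with $R_1,R_2$ non-empty sets satisfying (GR2), (WGR3) and $(R_1,R_2)=0$. *)

theory Defs
  imports
    Complex_Main
    "HOL-Algebra.Free_Abelian_Groups"
    "HOL-Computational_Algebra.Group_Closure"
begin

section \<open>Complex spaces with a symmetric bilinear form\<close>

text \<open>The space is the whole type \<open>'v\<close>. The set \<open>Basis\<close> only witnesses
  finite-dimensionality.\<close>

locale symmetric_form_space = finite_dimensional_vector_space scale Basis
  for scale :: "complex \<Rightarrow> 'v::ab_group_add \<Rightarrow> 'v" and Basis :: "'v set" +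
  fixes form :: "'v \<Rightarrow> 'v \<Rightarrow> complex"
  assumes form_sym: "form v w = form w v"
    and form_linear: "Vector_Spaces.linear scale (*) (form v)"

definition form_kernel :: "('v \<Rightarrow> 'v \<Rightarrow> complex) \<Rightarrow> 'v set" where
  "form_kernel form = {v. \<forall>w. form v w = 0}"

definition nondegenerate :: "('v::zero \<Rightarrow> 'v \<Rightarrow> complex) \<Rightarrow> bool" where
  "nondegenerate form \<longleftrightarrow> form_kernel form = {0}"

definition reflection ::
  "(complex \<Rightarrow> 'v::ab_group_add \<Rightarrow> 'v) \<Rightarrow> ('v \<Rightarrow> 'v \<Rightarrow> complex) \<Rightarrow> 'v \<Rightarrow> 'v \<Rightarrow> 'v" where
  "reflection scale form \<alpha> v = v - scale (2 * form \<alpha> v / form \<alpha> \<alpha>) \<alpha>"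


section \<open>Tensor products over the integers\<close>

text \<open>For additive subgroups \<open>A\<close> and \<open>B\<close> (of the groups carried by the types \<open>'a\<close> and \<open>'b\<close>),
  the tensor product over the integers is the free abelian group on \<open>A \<times> B\<close> modulo the
  biadditivity relations. Compatibility with integer multiples follows from biadditivity.\<close>

definition tensor_relations ::
  "'a::ab_group_add set \<Rightarrow> 'b::ab_group_add set \<Rightarrow> ('a \<times> 'b \<Rightarrow>\<^sub>0 int) set" where
  "tensor_relations A B =
     {frag_of (a + a', b) - frag_of (a, b) - frag_of (a', b) | a a' b. a \<in> A \<and> a' \<in> A \<and> b \<in> B}
   \<union> {frag_of (a, b + b') - frag_of (a, b) - frag_of (a, b') | a b b'. a \<in> A \<and> b \<in> B \<and> b' \<in> B}"

definition tensor_kernel ::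
  "'a::ab_group_add set \<Rightarrow> 'b::ab_group_add set \<Rightarrow> ('a \<times> 'b \<Rightarrow>\<^sub>0 int) set" where
  "tensor_kernel A B = generate (free_Abelian_group (A \<times> B)) (tensor_relations A B)"

definition tensor_int ::
  "'a::ab_group_add set \<Rightarrow> 'b::ab_group_add set \<Rightarrow> ('a \<times> 'b \<Rightarrow>\<^sub>0 int) set monoid" where
  "tensor_int A B = free_Abelian_group (A \<times> B) Mod tensor_kernel A B"

text \<open>The homomorphism from the free abelian group on pairs \<open>(v, c)\<close> to the vector space which
  sends the generator \<open>(v, c)\<close> to \<open>c v\<close>, and the map it induces on cosets (well defined by
  the lemma \<open>scalar_map_coset\<close> below), that is \<open>v \<otimes> c \<mapsto> c v\<close>.\<close>

definition scalar_eval ::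
  "(complex \<Rightarrow> 'v::ab_group_add \<Rightarrow> 'v) \<Rightarrow> ('v \<times> complex \<Rightarrow>\<^sub>0 int) \<Rightarrow> 'v" where
  "scalar_eval scale x =
     (\<Sum>p\<in>Poly_Mapping.keys x. scale (of_int (Poly_Mapping.lookup x p) * snd p) (fst p))"

definition scalar_map ::
  "(complex \<Rightarrow> 'v::ab_group_add \<Rightarrow> 'v) \<Rightarrow> ('v \<times> complex \<Rightarrow>\<^sub>0 int) set \<Rightarrow> 'v" where
  "scalar_map scale X = the_elem (scalar_eval scale ` X)"

context
  fixes scale :: "complex \<Rightarrow> 'v::ab_group_add \<Rightarrow> 'v"
  assumes vs: "vector_space scale"
begin

interpretation vector_space scale by (rule vs)

lemma scalar_eval_superset:
  assumes "finite S" "Poly_Mapping.keys x \<subseteq> S"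
  shows "scalar_eval scale x =
    (\<Sum>p\<in>S. scale (of_int (Poly_Mapping.lookup x p) * snd p) (fst p))"
  unfolding scalar_eval_def
  by (rule sum.mono_neutral_left) (use assms in \<open>auto simp: in_keys_iff\<close>)

lemma scalar_eval_frag_of: "scalar_eval scale (frag_of (v, c)) = scale c v"
  by (simp add: scalar_eval_def)

lemma scalar_eval_diff: "scalar_eval scale (x - y) = scalar_eval scale x - scalar_eval scale y"
proof -
  let ?S = "Poly_Mapping.keys x \<union> Poly_Mapping.keys y"
  have "Poly_Mapping.keys (x - y) \<subseteq> ?S"
    by (rule keys_diff)
  then show ?thesis
    by (simp add: scalar_eval_superset[of ?S] lookup_minus algebra_simps flip: sum_subtractf)
qed

lemma scalar_eval_add: "scalar_eval scale (x + y) = scalar_eval scale x + scalar_eval scale y"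
  using scalar_eval_diff[of "x + y" y] by simp

lemma scalar_eval_uminus: "scalar_eval scale (- x) = - scalar_eval scale x"
  using scalar_eval_diff[of 0 x] by (simp add: scalar_eval_def)

lemma scalar_eval_tensor_kernel:
  assumes A: "\<And>a a'. a \<in> A \<Longrightarrow> a' \<in> A \<Longrightarrow> a + a' \<in> A"
    and B: "\<And>b b'. b \<in> B \<Longrightarrow> b' \<in> B \<Longrightarrow> b + b' \<in> B"
    and x: "x \<in> tensor_kernel A B"
  shows "Poly_Mapping.keys x \<subseteq> A \<times> B" "scalar_eval scale x = 0"
proof -
  let ?G = "free_Abelian_group (A \<times> B)"
  have rel: "h \<in> carrier ?G" "scalar_eval scale h = 0" if "h \<in> tensor_relations A B" for h
  proof -
    show "h \<in> carrier ?G"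
      using that A B
      by (auto simp: tensor_relations_def dest!: subsetD[OF keys_diff] split: if_splits)
    show "scalar_eval scale h = 0"
      using that
      by (auto simp: tensor_relations_def scalar_eval_diff scalar_eval_frag_of
          scale_left_distrib scale_right_distrib)
  qed
  have "x \<in> carrier ?G \<and> scalar_eval scale x = 0"
    using x unfolding tensor_kernel_def
  proof (induction rule: generate.induct)
    case (eng h1 h2)
    then show ?case
      using keys_add[of h1 h2] by (auto simp: scalar_eval_add)
  qed (use rel in \<open>auto simp: scalar_eval_uminus scalar_eval_def[of _ 0]\<close>)
  then show "Poly_Mapping.keys x \<subseteq> A \<times> B" "scalar_eval scale x = 0"
    by auto
qed

lemma scalar_map_coset:
  assumes A: "\<And>a a'. a \<in> A \<Longrightarrow> a' \<in> A \<Longrightarrow> a + a' \<in> A"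
    and B: "\<And>b b'. b \<in> B \<Longrightarrow> b' \<in> B \<Longrightarrow> b + b' \<in> B"
  shows "scalar_map scale (tensor_kernel A B #>\<^bsub>free_Abelian_group (A \<times> B)\<^esub> x)
    = scalar_eval scale x"
proof -
  have "0 \<in> tensor_kernel A B"
    unfolding tensor_kernel_def
    using generate.one[of "free_Abelian_group (A \<times> B)"] by simp
  then have "scalar_eval scale ` (tensor_kernel A B #>\<^bsub>free_Abelian_group (A \<times> B)\<^esub> x)
      = {scalar_eval scale x}"
    using scalar_eval_tensor_kernel(2)[OF A B]
    by (force simp: r_coset_def scalar_eval_add)
  then show ?thesis
    by (simp add: scalar_map_def)
qed

end


section \<open>Axioms for root systems\<close>

definition GR0 :: "('v::ab_group_add \<Rightarrow> 'v \<Rightarrow> complex) \<Rightarrow> 'v set \<Rightarrow> bool" where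
  "GR0 form R \<longleftrightarrow> form_kernel form \<inter> R = {}"

definition GR1 :: "(complex \<Rightarrow> 'v::ab_group_add \<Rightarrow> 'v) \<Rightarrow> 'v set \<Rightarrow> bool" where
  "GR1 scale R \<longleftrightarrow>
     bij_betw (scalar_map scale) (carrier (tensor_int (group_closure R) (UNIV :: complex set))) UNIV"

definition GR2 ::
  "(complex \<Rightarrow> 'v::ab_group_add \<Rightarrow> 'v) \<Rightarrow> ('v \<Rightarrow> 'v \<Rightarrow> complex) \<Rightarrow> 'v set \<Rightarrow> bool" where
  "GR2 scale form R \<longleftrightarrow>
     (\<forall>\<alpha>\<in>R. form \<alpha> \<alpha> \<noteq> 0 \<longrightarrow>
        reflection scale form \<alpha> ` R = R \<and>
        (\<forall>\<beta>\<in>R. \<beta> - reflection scale form \<alpha> \<beta> \<in> group_closure {\<alpha>}))"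

definition WGR3 :: "('v::ab_group_add \<Rightarrow> 'v \<Rightarrow> complex) \<Rightarrow> 'v set \<Rightarrow> bool" where
  "WGR3 form R \<longleftrightarrow>
     (\<forall>\<alpha>\<in>R. form \<alpha> \<alpha> = 0 \<longrightarrow>
        (\<exists>r \<in> R \<rightarrow> R. r \<alpha> = - \<alpha> \<and> r (- \<alpha>) = \<alpha> \<and>
           (\<forall>\<beta>\<in>R. \<beta> \<noteq> \<alpha> \<and> \<beta> \<noteq> - \<alpha> \<and> form \<alpha> \<beta> = 0 \<longrightarrow> r \<beta> = \<beta>) \<and>
           (\<forall>\<beta>\<in>R. form \<alpha> \<beta> \<noteq> 0 \<longrightarrow> r \<beta> \<in> {\<beta> + \<alpha>, \<beta> - \<alpha>})))"

definition WGRS ::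
  "(complex \<Rightarrow> 'v::ab_group_add \<Rightarrow> 'v) \<Rightarrow> ('v \<Rightarrow> 'v \<Rightarrow> complex) \<Rightarrow> 'v set \<Rightarrow> bool" where
  "WGRS scale form R \<longleftrightarrow>
     nondegenerate form \<and> R \<noteq> {} \<and>
     GR0 form R \<and> GR1 scale R \<and> GR2 scale form R \<and> WGR3 form R"

definition irreducible_roots ::
  "(complex \<Rightarrow> 'v::ab_group_add \<Rightarrow> 'v) \<Rightarrow> ('v \<Rightarrow> 'v \<Rightarrow> complex) \<Rightarrow> 'v set \<Rightarrow> bool" where
  "irreducible_roots scale form R \<longleftrightarrow>
     GR0 form R \<and> GR2 scale form R \<and> WGR3 form R \<and>
     \<not> (\<exists>R1 R2. R = R1 \<union> R2 \<and> R1 \<inter> R2 = {} \<and> R1 \<noteq> {} \<and> R2 \<noteq> {} \<and>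
          GR2 scale form R1 \<and> WGR3 form R1 \<and> GR2 scale form R2 \<and> WGR3 form R2 \<and>
          (\<forall>\<alpha>\<in>R1. \<forall>\<beta>\<in>R2. form \<alpha> \<beta> = 0))"

end

theory Submission
  imports Defs
begin

text \<open>Let \<open>k = 2(\<gamma>,\<alpha>)/(\<gamma>,\<gamma>)\<close> for \<open>\<gamma>\<close> anisotropic and \<open>\<alpha>\<close> isotropic. One of \<open>\<gamma> \<plusminus> \<alpha>\<close> is a root,
  and its integrality forces \<open>k \<in> {0, \<plusminus>1, \<plusminus>2}\<close>. The form is nondegenerate on the span of the
  isotropic roots, so up to finitely many scalar multiples an anisotropic root in this span is
  determined by its integers \<open>k\<close> on a basis of isotropic roots: there are finitely many.
  An isotropic root \<open>\<alpha>\<close> is not orthogonal to some isotropic root \<open>\<beta>\<close> of that basis, and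
  \<open>\<beta> \<plusminus> \<alpha>\<close> is then one of these anisotropic roots, so there are finitely many isotropic roots.
  For irreducible \<open>R\<close> these are all the roots.

  For (GR1) it suffices to find linear functionals which are integral on \<open>R\<close> and separate points.
  Take the coroots of the anisotropic roots together with \<open>(s,-)/(s,s)\<close>, where \<open>s\<close> is the average
  of the (finitely many) isotropic roots in a coset modulo the span \<open>U\<close> of the anisotropic roots.
  The average is fixed by all reflections, hence orthogonal to \<open>U\<close>. If two averages are not
  orthogonal, then some members \<open>\<alpha>, \<beta>\<close> of the two cosets are not, so \<open>\<beta> \<plusminus> \<alpha>\<close> lies in \<open>U\<close> and the
  averages agree up to sign; this gives integrality.\<close>

section \<open>Integral functionals and (GR1)\<close>

text \<open>Over the rationals \<open>{1}\<close> is independent in the complex numbers, so a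
  rational linear functional with value 1 there exists.\<close>

lemma rational_projection:
  obtains \<pi> :: "complex \<Rightarrow> rat"
  where "\<And>x y. \<pi> (x + y) = \<pi> x + \<pi> y" "\<And>n x. \<pi> (of_int n * x) = of_int n * \<pi> x" "\<pi> 1 = 1"
proof -
  interpret C: vector_space "\<lambda>q z :: complex. of_rat q * z"
    by unfold_locales (simp_all add: algebra_simps of_rat_add of_rat_mult)
  interpret Q: vector_space "(*) :: rat \<Rightarrow> rat \<Rightarrow> rat"
    by unfold_locales (auto simp: algebra_simps)
  interpret CQ: vector_space_pair "\<lambda>q z :: complex. of_rat q * z" "(*) :: rat \<Rightarrow> rat \<Rightarrow> rat"
    by unfold_locales
  define \<pi> where "\<pi> = CQ.construct {1} (\<lambda>_. 1)"
  have ind: "C.independent {1}"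
    by (simp add: C.dependent_single)
  interpret \<pi>: Vector_Spaces.linear "\<lambda>q z :: complex. of_rat q * z" "(*) :: rat \<Rightarrow> rat \<Rightarrow> rat" \<pi>
    unfolding \<pi>_def by (rule CQ.linear_construct[OF ind])
  show thesis
  proof
    show "\<pi> (x + y) = \<pi> x + \<pi> y" for x y
      by (rule \<pi>.add)
    show "\<pi> (of_int n * x) = of_int n * \<pi> x" for n x
      using \<pi>.scale[of "of_int n" x] by simp
    show "\<pi> 1 = 1"
      unfolding \<pi>_def using CQ.construct_basis[OF ind, of 1] by simp
  qed
qed

text \<open>The preimage of a subgroup is a subgroup. With \<open>A\<close> the integers, this
  carries integrality of a functional from generators to the group they generate.\<close>

lemma group_closure_group_hom:
  fixes f :: "'a::ab_group_add \<Rightarrow> 'b::ab_group_add"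
  assumes f: "\<And>x y. f (x - y) = f x - f y"
    and A: "0 \<in> A" "\<And>a b. a \<in> A \<Longrightarrow> b \<in> A \<Longrightarrow> a - b \<in> A"
    and S: "\<And>x. x \<in> S \<Longrightarrow> f x \<in> A"
    and x: "x \<in> group_closure S"
  shows "f x \<in> A"
  using x
proof induction
  case (base s)
  have "f 0 = 0"
    using f[of 0 0] by simp
  with base S A(1) show ?case
    by auto
next
  case (diff s t)
  then show ?case
    using A(2) by (simp add: f)
qed

section \<open>Calculus in the tensor product of a subgroup with the complex numbers\<close>

locale integral_tensor = vector_space scale
  for scale :: "complex \<Rightarrow> 'v::ab_group_add \<Rightarrow> 'v" +
  fixes L :: "'v set"
  assumes L_zero: "0 \<in> L"
    and L_diff: "x \<in> L \<Longrightarrow> y \<in> L \<Longrightarrow> x - y \<in> L"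
begin

abbreviation "G \<equiv> free_Abelian_group (L \<times> (UNIV :: complex set))"

abbreviation "K \<equiv> tensor_kernel L (UNIV :: complex set)"

text \<open>Equality of classes in the tensor product, phrased on representatives so that
  computations avoid cosets.\<close>

definition tensor_eq :: "('v \<times> complex \<Rightarrow>\<^sub>0 int) \<Rightarrow> ('v \<times> complex \<Rightarrow>\<^sub>0 int) \<Rightarrow> bool"
    (infix \<open>\<simeq>\<close> 50)
  where "x \<simeq> y \<longleftrightarrow> x - y \<in> K"

lemma L_uminus: "x \<in> L \<Longrightarrow> - x \<in> L"
  using L_diff[OF L_zero] by simp

lemma L_add: "x \<in> L \<Longrightarrow> y \<in> L \<Longrightarrow> x + y \<in> L"
  using L_diff[OF _ L_uminus, of x y] by simp

lemma L_sum: "(\<And>i. i \<in> I \<Longrightarrow> g i \<in> L) \<Longrightarrow> (\<Sum>i\<in>I. g i) \<in> L"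
  by (induction I rule: infinite_finite_induct) (auto simp: L_zero L_add)

lemma L_scale_int:
  assumes "x \<in> L"
  shows "scale (of_int n) x \<in> L"
proof -
  have nat: "scale (of_nat k) x \<in> L" for k
    by (induction k) (auto simp: L_zero L_add assms algebra_simps)
  show ?thesis
    by (cases n rule: int_cases2) (use nat in \<open>auto simp: L_uminus scale_minus_left\<close>)
qed

lemma tensor_kernel_zero: "0 \<in> K"
  unfolding tensor_kernel_def
  using generate.one[of "G"] by simp

lemma tensor_kernel_add:
  "x \<in> K \<Longrightarrow> y \<in> K \<Longrightarrow> x + y \<in> K"
  unfolding tensor_kernel_def
  using generate.eng[of x "G" _ y] by simp

lemma tensor_kernel:
  assumes "x \<in> K"
  shows "Poly_Mapping.keys x \<subseteq> L \<times> UNIV" "scalar_eval scale x = 0"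
  using scalar_eval_tensor_kernel[OF vector_space_axioms _ _ assms] by (auto simp: L_add)

lemma tensor_relations_carrier:
  "tensor_relations L (UNIV :: complex set) \<subseteq> carrier (G)"
proof
  fix x assume "x \<in> tensor_relations L (UNIV :: complex set)"
  then have "x \<in> K"
    unfolding tensor_kernel_def by (rule generate.incl)
  then show "x \<in> carrier (G)"
    using tensor_kernel(1) by simp
qed

lemma tensor_kernel_uminus:
  assumes "x \<in> K"
  shows "- x \<in> K"
  using group.generate_m_inv_closed[OF group_free_Abelian_group tensor_relations_carrier,
      of x] tensor_kernel(1)[OF assms] assms
  by (simp add: tensor_kernel_def)

lemma tensor_eq_refl: "x \<simeq> x"
  by (simp add: tensor_eq_def tensor_kernel_zero)

lemma tensor_eq_sym: "x \<simeq> y \<Longrightarrow> y \<simeq> x"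
  unfolding tensor_eq_def using tensor_kernel_uminus[of "x - y"] by simp

lemma tensor_eq_trans [trans]: "x \<simeq> y \<Longrightarrow> y \<simeq> z \<Longrightarrow> x \<simeq> z"
  unfolding tensor_eq_def using tensor_kernel_add[of "x - y" "y - z"] by simp

lemma tensor_eq_add: "x \<simeq> y \<Longrightarrow> x' \<simeq> y' \<Longrightarrow> x + x' \<simeq> y + y'"
  unfolding tensor_eq_def using tensor_kernel_add[of "x - y" "x' - y'"]
  by (simp add: algebra_simps)

lemma tensor_eq_uminus: "x \<simeq> y \<Longrightarrow> - x \<simeq> - y"
  unfolding tensor_eq_def using tensor_kernel_uminus[of "x - y"] by simp

lemma tensor_eq_diff: "x \<simeq> y \<Longrightarrow> x' \<simeq> y' \<Longrightarrow> x - x' \<simeq> y - y'"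
  using tensor_eq_add[OF _ tensor_eq_uminus, of x y x' y'] by simp

lemma tensor_eq_sum: "(\<And>i. i \<in> I \<Longrightarrow> x i \<simeq> y i) \<Longrightarrow> (\<Sum>i\<in>I. x i) \<simeq> (\<Sum>i\<in>I. y i)"
  by (induction I rule: infinite_finite_induct) (auto simp: tensor_eq_refl intro: tensor_eq_add)

lemma scalar_eval_cong: "x \<simeq> y \<Longrightarrow> scalar_eval scale x = scalar_eval scale y"
  using tensor_kernel(2)[of "x - y"] scalar_eval_diff[OF vector_space_axioms, of x y]
  by (simp add: tensor_eq_def)

lemma scalar_eval_sum:
  "scalar_eval scale (\<Sum>i\<in>I. x i) = (\<Sum>i\<in>I. scalar_eval scale (x i))"
  by (induction I rule: infinite_finite_induct)
    (auto simp: scalar_eval_add[OF vector_space_axioms] scalar_eval_def[of _ 0])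

lemma frag_add_left:
  assumes "x \<in> L" "y \<in> L"
  shows "frag_of (x + y, c) \<simeq> frag_of (x, c) + frag_of (y, c)"
  unfolding tensor_eq_def tensor_kernel_def
  by (rule generate.incl) (use assms in \<open>force simp: tensor_relations_def algebra_simps\<close>)

lemma frag_add_right:
  assumes "x \<in> L"
  shows "frag_of (x, c + d) \<simeq> frag_of (x, c) + frag_of (x, d)"
  unfolding tensor_eq_def tensor_kernel_def
  by (rule generate.incl) (use assms in \<open>force simp: tensor_relations_def algebra_simps\<close>)

lemma frag_zero_left: "frag_of (0, c) \<simeq> 0"
  using tensor_eq_uminus[OF frag_add_left[OF L_zero L_zero, of c]] by (simp add: tensor_eq_def)

lemma frag_zero_right: "x \<in> L \<Longrightarrow> frag_of (x, 0) \<simeq> 0"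
  using tensor_eq_uminus[OF frag_add_right[of x 0 0]] by (simp add: tensor_eq_def)

lemma frag_sum_left:
  "(\<And>i. i \<in> I \<Longrightarrow> g i \<in> L) \<Longrightarrow> frag_of (\<Sum>i\<in>I. g i, c) \<simeq> (\<Sum>i\<in>I. frag_of (g i, c))"
proof (induction I rule: infinite_finite_induct)
  case (insert i I)
  have "frag_of (g i + (\<Sum>i\<in>I. g i), c) \<simeq> frag_of (g i, c) + frag_of (\<Sum>i\<in>I. g i, c)"
    by (rule frag_add_left) (use insert in \<open>auto intro: L_sum\<close>)
  also have "\<dots> \<simeq> frag_of (g i, c) + (\<Sum>i\<in>I. frag_of (g i, c))"
    by (rule tensor_eq_add[OF tensor_eq_refl]) (use insert in auto)
  finally show ?case
    using insert by simp
qed (auto simp: frag_zero_left)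

text \<open>Both sides are inverse to the class of \<open>frag_of (x, c)\<close>, by additivity in
  the first and in the second slot.\<close>

lemma frag_minus_shift:
  assumes "x \<in> L"
  shows "frag_of (- x, c) \<simeq> frag_of (x, - c)"
proof -
  have "frag_of (x, c) + frag_of (- x, c) \<simeq> 0"
    using tensor_eq_trans[OF tensor_eq_sym[OF frag_add_left[of x "- x" c]]] frag_zero_left[of c]
      assms L_uminus by simp
  moreover have "frag_of (x, c) + frag_of (x, - c) \<simeq> 0"
    using tensor_eq_trans[OF tensor_eq_sym[OF frag_add_right[of x c "- c"]] ]
      frag_zero_right[of x] assms by simp
  ultimately have "(frag_of (x, c) + frag_of (- x, c)) - (frag_of (x, c) + frag_of (x, - c)) \<simeq> 0 - 0"
    by (rule tensor_eq_diff)
  then show ?thesis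
    by (simp add: tensor_eq_def)
qed

text \<open>Integers cross the tensor sign: induction with additivity in both slots for natural
  numbers, \<open>frag_minus_shift\<close> for the sign. This allows denominators to be
  cleared.\<close>

lemma frag_int_shift:
  assumes x: "x \<in> L"
  shows "frag_of (scale (of_int n) x, c) \<simeq> frag_of (x, of_int n * c)"
proof -
  have nat: "frag_of (scale (of_nat k) x, c) \<simeq> frag_of (x, of_nat k * c)" for k c
  proof (induction k)
    case 0
    show ?case
      using frag_zero_left[of c] tensor_eq_sym[OF frag_zero_right[OF x]]
      by (auto intro: tensor_eq_trans)
  next
    case (Suc k)
    have kx: "scale (of_nat k) x \<in> L"
      using L_scale_int[OF x, of "int k"] by simp
    have "frag_of (x + scale (of_nat k) x, c) \<simeq> frag_of (x, c) + frag_of (scale (of_nat k) x, c)"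
      by (rule frag_add_left[OF x kx])
    also have "\<dots> \<simeq> frag_of (x, c) + frag_of (x, of_nat k * c)"
      by (rule tensor_eq_add[OF tensor_eq_refl Suc])
    also have "\<dots> \<simeq> frag_of (x, c + of_nat k * c)"
      by (rule tensor_eq_sym[OF frag_add_right[OF x]])
    finally show ?case
      by (simp add: scale_left_distrib algebra_simps)
  qed
  show ?thesis
  proof (cases n rule: int_cases2)
    case (nonneg k)
    then show ?thesis
      using nat[of k c] by simp
  next
    case (nonpos k)
    have "frag_of (- scale (of_nat k) x, c) \<simeq> frag_of (scale (of_nat k) x, - c)"
      using frag_minus_shift[OF L_scale_int[OF x, of "int k"], of c] by simp
    also have "\<dots> \<simeq> frag_of (x, of_nat k * (- c))"
      by (rule nat)
    finally show ?thesis
      using nonpos by (simp add: scale_minus_left)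
  qed
qed

lemma tensor_coset_eq:
  assumes "x \<simeq> y"
  shows "K #>\<^bsub>G\<^esub> x =
    K #>\<^bsub>G\<^esub> y"
proof -
  have "K #>\<^bsub>G\<^esub> x \<subseteq>
    K #>\<^bsub>G\<^esub> y" if "x \<simeq> y" for x y
  proof
    fix z
    assume "z \<in> K #>\<^bsub>G\<^esub> x"
    then obtain h where h: "h \<in> K" "z = h + x"
      by (auto simp: r_coset_def)
    have "h + (x - y) \<in> K" "z = (h + (x - y)) \<otimes>\<^bsub>G\<^esub> y"
      using tensor_kernel_add[OF h(1), of "x - y"] that h(2) by (auto simp: tensor_eq_def)
    then show "z \<in> K #>\<^bsub>G\<^esub> y"
      unfolding r_coset_def by blast
  qed
  from this[OF assms] this[OF tensor_eq_sym[OF assms]] show ?thesis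
    by (rule subset_antisym)
qed

text \<open>On a coset \<open>scalar_map\<close> takes the value of \<open>scalar_eval\<close> at
  any representative, so bijectivity reduces to statements about formal sums.\<close>

lemma scalar_map_bij:
  assumes surj: "\<And>v. \<exists>x. Poly_Mapping.keys x \<subseteq> L \<times> UNIV \<and> scalar_eval scale x = v"
    and inj: "\<And>x. Poly_Mapping.keys x \<subseteq> L \<times> UNIV \<Longrightarrow> scalar_eval scale x = 0 \<Longrightarrow> x \<simeq> 0"
  shows "bij_betw (scalar_map scale) (carrier (tensor_int L (UNIV :: complex set))) UNIV"
proof -
  let ?coset = "\<lambda>x. K #>\<^bsub>G\<^esub> x"
  have carrier: "carrier (tensor_int L (UNIV :: complex set)) =
      ?coset ` {x. Poly_Mapping.keys x \<subseteq> L \<times> UNIV}"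
    by (auto simp: tensor_int_def FactGroup_def RCOSETS_def)
  have map: "scalar_map scale (?coset x) = scalar_eval scale x" for x
    by (rule scalar_map_coset[OF vector_space_axioms]) (auto intro: L_add)
  show ?thesis
  proof (intro bij_betwI')
    fix X Y
    assume "X \<in> carrier (tensor_int L (UNIV :: complex set))"
      "Y \<in> carrier (tensor_int L (UNIV :: complex set))"
    then obtain x y where x: "X = ?coset x" "Poly_Mapping.keys x \<subseteq> L \<times> UNIV"
      and y: "Y = ?coset y" "Poly_Mapping.keys y \<subseteq> L \<times> UNIV"
      unfolding carrier by auto
    show "scalar_map scale X = scalar_map scale Y \<longleftrightarrow> X = Y"
    proof
      assume "scalar_map scale X = scalar_map scale Y"
      then have "scalar_eval scale (x - y) = 0"
        by (simp add: x(1) y(1) map scalar_eval_diff[OF vector_space_axioms])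
      moreover have "Poly_Mapping.keys (x - y) \<subseteq> L \<times> UNIV"
        using x y keys_diff[of x y] by blast
      ultimately have "x - y \<simeq> 0"
        using inj by blast
      then have "x \<simeq> y"
        by (simp add: tensor_eq_def)
      then show "X = Y"
        using x(1) y(1) tensor_coset_eq by simp
    qed simp
  next
    fix v
    obtain x where "Poly_Mapping.keys x \<subseteq> L \<times> UNIV" "scalar_eval scale x = v"
      using surj by blast
    then show "\<exists>X\<in>carrier (tensor_int L (UNIV :: complex set)). v = scalar_map scale X"
      unfolding carrier by (intro bexI[of _ "?coset x"]) (auto simp: map)
  qed simp
qed

end

lemma common_denominator:
  fixes u :: "'a \<Rightarrow> complex"
  assumes "finite B" "\<And>b. b \<in> B \<Longrightarrow> u b \<in> \<rat>"
  obtains N :: int where "N \<noteq> 0" "\<And>b. b \<in> B \<Longrightarrow> of_int N * u b \<in> \<int>"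
proof -
  have "\<exists>N::int. N \<noteq> 0 \<and> (\<forall>b\<in>B. of_int N * u b \<in> \<int>)"
    using assms
  proof (induction B)
    case empty
    show ?case
      by (intro exI[of _ 1]) simp
  next
    case (insert b B)
    then obtain N :: int where N: "N \<noteq> 0" "\<forall>b\<in>B. of_int N * u b \<in> \<int>"
      by auto
    obtain m n :: int where mn: "n > 0" "u b = of_int m / of_int n"
      using insert.prems[of b] by (auto elim: Rats_cases')
    have "of_int (N * n) * u b = of_int (N * m)"
      using mn by simp
    then have "of_int (N * n) * u b \<in> \<int>"
      using Ints_of_int by metis
    moreover have "of_int (N * n) * u b' \<in> \<int>" if "b' \<in> B" for b'
      using Ints_mult[of "of_int n" "of_int N * u b'"] N(2) that by (simp add: ac_simps)
    ultimately show ?case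
      using N(1) mn(1) by (intro exI[of _ "N * n"]) auto
  qed
  with that show thesis
    by blast
qed

text \<open>Integral functionals force the coordinates of a lattice element with respect to a basis
  \<open>B \<subseteq> R\<close> to be rational: replacing the coordinates by their images under a rational linear
  projection of the complex numbers onto the rationals does not change the values of the
  functionals. After clearing denominators each tensor becomes \<open>\<Sum>b\<in>B. b \<otimes> d b\<close>.\<close>

lemma GR1_if_integral_functionals:
  fixes scale :: "complex \<Rightarrow> 'v::ab_group_add \<Rightarrow> 'v"
  assumes "finite_dimensional_vector_space scale Basis"
    and span: "module.span scale R = UNIV"
    and lin: "\<And>f. f \<in> F \<Longrightarrow> Vector_Spaces.linear scale (*) f"
    and int: "\<And>f x. f \<in> F \<Longrightarrow> x \<in> R \<Longrightarrow> f x \<in> \<int>"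
    and sep: "\<And>v. (\<And>f. f \<in> F \<Longrightarrow> f v = 0) \<Longrightarrow> v = 0"
  shows "GR1 scale R"
proof -
  interpret finite_dimensional_vector_space scale Basis by fact
  interpret integral_tensor scale "group_closure R"
    by unfold_locales (auto intro: group_closure.diff)
  write tensor_eq (infix \<open>\<simeq>\<close> 50)
  obtain B where B: "B \<subseteq> R" "independent B" "R \<subseteq> span B"
    using maximal_independent_subset[of R] by blast
  have span_B: "span B = UNIV"
    using span span_mono[OF B(3)] by (auto simp: span_span)
  have fin: "finite B"
    using B(2) by (rule finiteI_independent)
  have BL: "b \<in> group_closure R" if "b \<in> B" for b
    using that B(1) by (auto intro: group_closure.base)
  have expand: "x = (\<Sum>b\<in>B. scale (representation B x b) b)" for x
    using sum_representation_eq[OF B(2) _ fin order_refl, of x] span_B by simp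
  have coeff: "d b = 0" if "(\<Sum>b\<in>B. scale (d b) b) = 0" "b \<in> B" for d b
    using independentD[OF B(2) fin order_refl that] .
  obtain \<pi> :: "complex \<Rightarrow> rat" where \<pi>: "\<And>x y. \<pi> (x + y) = \<pi> x + \<pi> y"
    "\<And>n x. \<pi> (of_int n * x) = of_int n * \<pi> x" "\<pi> 1 = 1"
    by (rule rational_projection) blast
  have \<pi>_zero: "\<pi> 0 = 0"
    using \<pi>(1)[of 0 0] by simp
  have \<pi>_sum: "\<pi> (\<Sum>i\<in>I. g i) = (\<Sum>i\<in>I. \<pi> (g i))" for g and I :: "'v set"
    by (induction I rule: infinite_finite_induct) (auto simp: \<pi>(1) \<pi>_zero)
  have rational: "representation B x b \<in> \<rat>" if x: "x \<in> group_closure R" and b: "b \<in> B" for x b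
  proof -
    define y where "y = (\<Sum>b\<in>B. scale (of_rat (\<pi> (representation B x b))) b)"
    have "f (y - x) = 0" if f: "f \<in> F" for f
    proof -
      interpret f: Vector_Spaces.linear scale "(*)" f
        by (rule lin[OF f])
      have "f x \<in> \<int>"
        by (rule group_closure_group_hom[OF f.diff _ _ int[OF f] x]) auto
      then have fx: "of_rat (\<pi> (f x)) = f x"
        using \<pi>(2)[of _ 1] \<pi>(3) by (auto elim!: Ints_cases)
      \<comment> \<open>The integer \<open>f b\<close> passes through \<open>\<pi>\<close>, so
        \<open>f y\<close> is the image of \<open>f x\<close>, which is itself an integer and hence
        fixed.\<close>
      have fb: "of_rat (\<pi> z) * f b = of_rat (\<pi> (z * f b))" if b: "b \<in> B" for z b
      proof -
        obtain n where "f b = of_int n"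
          using int[OF f, of b] B(1) b by (auto elim: Ints_cases)
        then show ?thesis
          using \<pi>(2)[of n z] by (simp add: of_rat_mult mult.commute[of _ "of_int n"])
      qed
      have "f y = (\<Sum>b\<in>B. of_rat (\<pi> (representation B x b)) * f b)"
        by (simp add: y_def f.sum f.scale)
      also have "\<dots> = of_rat (\<pi> (\<Sum>b\<in>B. representation B x b * f b))"
        by (simp add: fb \<pi>_sum of_rat_sum)
      also have "(\<Sum>b\<in>B. representation B x b * f b) = f (\<Sum>b\<in>B. scale (representation B x b) b)"
        by (simp add: f.sum f.scale)
      finally show ?thesis
        using fx expand[of x] by (simp add: f.diff)
    qed
    then have "y = x"
      using sep[of "y - x"] by simp
    then have "(\<Sum>b\<in>B. scale (representation B x b - of_rat (\<pi> (representation B x b))) b) = 0"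
      using expand[of x] by (simp add: y_def scale_left_diff_distrib sum_subtractf)
    from coeff[OF this b] have "representation B x b = of_rat (\<pi> (representation B x b))"
      by simp
    then show ?thesis
      by (metis Rats_of_rat)
  qed
  have normal_frag: "\<exists>d. frag_of (x, c) \<simeq> (\<Sum>b\<in>B. frag_of (b, d b))"
    if x: "x \<in> group_closure R" for x c
  proof -
    obtain N :: int where N: "N \<noteq> 0" "\<And>b. b \<in> B \<Longrightarrow> of_int N * representation B x b \<in> \<int>"
      by (rule common_denominator[OF fin, of "representation B x"]) (use rational[OF x] in auto)
    then have "\<forall>b\<in>B. \<exists>m::int. of_int N * representation B x b = of_int m"
      by (auto elim: Ints_cases)
    then obtain m :: "'v \<Rightarrow> int"
      where m: "\<And>b. b \<in> B \<Longrightarrow> of_int N * representation B x b = of_int (m b)"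
      by metis
    have Nx: "scale (of_int N) x = (\<Sum>b\<in>B. scale (of_int (m b)) b)"
      by (subst expand[of x]) (simp add: scale_sum_right m)
    \<comment> \<open>The denominator \<open>N\<close> is split off in the complex slot, where
      division is possible, and moved to the left, where it makes the coordinates integral.\<close>
    have "frag_of (x, c) = frag_of (x, of_int N * (c / of_int N))"
      using N(1) by simp
    also have "\<dots> \<simeq> frag_of (scale (of_int N) x, c / of_int N)"
      by (rule tensor_eq_sym[OF frag_int_shift[OF x]])
    also have "\<dots> \<simeq> (\<Sum>b\<in>B. frag_of (scale (of_int (m b)) b, c / of_int N))"
      unfolding Nx by (rule frag_sum_left) (auto intro: L_scale_int BL)
    also have "\<dots> \<simeq> (\<Sum>b\<in>B. frag_of (b, of_int (m b) * (c / of_int N)))"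
      by (rule tensor_eq_sum[OF frag_int_shift[OF BL]])
    finally show ?thesis
      by (rule exI[of _ "\<lambda>b. of_int (m b) * (c / of_int N)"])
  qed
  have normal: "\<exists>d. x \<simeq> (\<Sum>b\<in>B. frag_of (b, d b))"
    if "Poly_Mapping.keys x \<subseteq> group_closure R \<times> UNIV" for x :: "'v \<times> complex \<Rightarrow>\<^sub>0 int"
    using that
  proof (induction x rule: frag_induction)
    case zero
    have "(\<Sum>b\<in>B. frag_of (b, 0)) \<simeq> (\<Sum>b\<in>B. 0)"
      by (rule tensor_eq_sum) (auto intro: frag_zero_right BL)
    from tensor_eq_sym[OF this] show ?case
      by (intro exI[of _ "\<lambda>_. 0"]) simp
  next
    case (one p)
    then show ?case
      using normal_frag by (cases p) auto
  next
    case (diff x y)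
    then obtain d e where "x \<simeq> (\<Sum>b\<in>B. frag_of (b, d b))" "y \<simeq> (\<Sum>b\<in>B. frag_of (b, e b))"
      by blast
    then have "x - y \<simeq> (\<Sum>b\<in>B. frag_of (b, d b) - frag_of (b, e b))"
      by (simp add: sum_subtractf tensor_eq_diff)
    also have "\<dots> \<simeq> (\<Sum>b\<in>B. frag_of (b, d b - e b))"
    proof (rule tensor_eq_sum)
      fix b assume "b \<in> B"
      \<comment> \<open>The relations speak of sums only, so \<open>d b\<close> is split as
        \<open>(d b - e b) + e b\<close>.\<close>
      from frag_add_right[OF BL[OF this], of "d b - e b" "e b"]
      have "frag_of (b, d b) \<simeq> frag_of (b, d b - e b) + frag_of (b, e b)"
        by simp
      from tensor_eq_diff[OF this tensor_eq_refl[of "frag_of (b, e b)"]]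
      show "frag_of (b, d b) - frag_of (b, e b) \<simeq> frag_of (b, d b - e b)"
        by simp
    qed
    finally show ?case
      by (rule exI[of _ "\<lambda>b. d b - e b"])
  qed
  have eval: "scalar_eval scale (\<Sum>b\<in>B. frag_of (b, d b)) = (\<Sum>b\<in>B. scale (d b) b)" for d
    by (simp add: scalar_eval_sum scalar_eval_frag_of[OF vector_space_axioms])
  show ?thesis
    unfolding GR1_def
  proof (rule scalar_map_bij)
    fix v
    have "Poly_Mapping.keys (\<Sum>b\<in>B. frag_of (b, representation B v b)) \<subseteq> group_closure R \<times> UNIV"
      using BL by (intro order_trans[OF keys_sum]) auto
    moreover have "scalar_eval scale (\<Sum>b\<in>B. frag_of (b, representation B v b)) = v"
      unfolding eval by (rule expand[symmetric])
    ultimately show "\<exists>x. Poly_Mapping.keys x \<subseteq> group_closure R \<times> UNIV \<and> scalar_eval scale x = v"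
      by blast
  next
    fix x :: "'v \<times> complex \<Rightarrow>\<^sub>0 int"
    assume keys: "Poly_Mapping.keys x \<subseteq> group_closure R \<times> UNIV" and x0: "scalar_eval scale x = 0"
    obtain d where d: "x \<simeq> (\<Sum>b\<in>B. frag_of (b, d b))"
      using normal[OF keys] by blast
    \<comment> \<open>A normal form evaluates to a linear combination of the basis, so independence
      kills every \<open>d b\<close> and with it the tensor.\<close>
    then have "(\<Sum>b\<in>B. scale (d b) b) = 0"
      using scalar_eval_cong[OF d] x0 by (simp add: eval)
    then have "d b = 0" if "b \<in> B" for b
      using coeff that by blast
    then have "(\<Sum>b\<in>B. frag_of (b, d b)) \<simeq> (\<Sum>b\<in>B. 0)"
      by (intro tensor_eq_sum) (auto intro: frag_zero_right BL)
    with d show "x \<simeq> 0"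
      using tensor_eq_trans by simp
  qed
qed

section \<open>Isotropic and non-isotropic roots\<close>

context symmetric_form_space
begin

lemma form_add_right: "form v (x + y) = form v x + form v y"
  and form_diff_right: "form v (x - y) = form v x - form v y"
  and form_scale_right: "form v (scale c x) = c * form v x"
  and form_uminus_right: "form v (- x) = - form v x"
  and form_zero_right: "form v 0 = 0"
  and form_sum_right: "form v (\<Sum>i\<in>I. g i) = (\<Sum>i\<in>I. form v (g i))"
proof -
  interpret f: Vector_Spaces.linear scale "(*)" "form v"
    by (rule form_linear)
  show "form v (x + y) = form v x + form v y" "form v (x - y) = form v x - form v y"
    "form v (scale c x) = c * form v x" "form v (- x) = - form v x" "form v 0 = 0"
    "form v (\<Sum>i\<in>I. g i) = (\<Sum>i\<in>I. form v (g i))"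
    by (rule f.add f.diff f.scale f.neg f.zero f.sum)+
qed

lemma form_add_left: "form (x + y) v = form x v + form y v"
  and form_diff_left: "form (x - y) v = form x v - form y v"
  and form_scale_left: "form (scale c x) v = c * form x v"
  and form_uminus_left: "form (- x) v = - form x v"
  and form_zero_left: "form 0 v = 0"
  and form_sum_left: "form (\<Sum>i\<in>I. g i) v = (\<Sum>i\<in>I. form (g i) v)"
  by (simp_all add: form_sym[of _ v] form_add_right form_diff_right form_scale_right
      form_uminus_right form_zero_right form_sum_right)

lemmas form_simps = form_add_right form_diff_right form_scale_right form_uminus_right
  form_zero_right form_sum_right form_add_left form_diff_left form_scale_left form_uminus_left
  form_zero_left form_sum_left

lemma orthogonal_span:
  assumes "\<And>s. s \<in> S \<Longrightarrow> form v s = 0" "w \<in> span S"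
  shows "form v w = 0"
  using assms(2,1) by (induction rule: span_induct_alt) (auto simp: form_simps)

lemma reflection_reflection:
  "form \<alpha> \<alpha> \<noteq> 0 \<Longrightarrow> reflection scale form \<alpha> (reflection scale form \<alpha> v) = v"
  by (simp add: reflection_def form_simps algebra_simps add_divide_distrib diff_divide_distrib)

lemma form_reflection:
  "form \<alpha> \<alpha> \<noteq> 0 \<Longrightarrow>
    form (reflection scale form \<alpha> v) (reflection scale form \<alpha> w) = form v w"
  by (simp add: reflection_def form_simps form_sym[of v \<alpha>] field_simps)

end

lemma int_dvd_4_cases:
  fixes i j :: int
  assumes "i * j = 4"
  shows "i \<in> {1, -1, 2, -2, 4, -4}"
proof -
  have "i dvd 4"
    using assms by (metis dvd_triv_left)
  then have "\<bar>i\<bar> \<le> 4" "i \<noteq> 3" "i \<noteq> -3" "i \<noteq> 0"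
    using zdvd_imp_le[of "\<bar>i\<bar>" 4] by auto
  then show ?thesis
    by auto
qed

section \<open>Cartan integers and the span of the isotropic roots\<close>

locale weak_roots = symmetric_form_space scale Basis form
  for scale :: "complex \<Rightarrow> 'v::ab_group_add \<Rightarrow> 'v" and Basis form +
  fixes R :: "'v set"
  assumes nondegenerate: "nondegenerate form"
    and span_R: "span R = UNIV"
    and GR0: "GR0 form R"
    and GR2: "GR2 scale form R"
    and WGR3: "WGR3 form R"
begin

definition "isotropic = {\<alpha> \<in> R. form \<alpha> \<alpha> = 0}"

definition "anisotropic = {\<alpha> \<in> R. form \<alpha> \<alpha> \<noteq> 0}"

lemma eq_zero_if_orthogonal:
  assumes "\<And>\<beta>. \<beta> \<in> R \<Longrightarrow> form v \<beta> = 0"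
  shows "v = 0"
proof -
  have "form v w = 0" for w
    by (rule orthogonal_span[of R]) (use assms span_R in auto)
  then show ?thesis
    using nondegenerate by (auto simp: nondegenerate_def form_kernel_def)
qed

lemma root_nonzero: "\<alpha> \<in> R \<Longrightarrow> \<alpha> \<noteq> 0"
  using GR0 form_zero_left by (auto simp: GR0_def form_kernel_def)

lemma root_cases:
  assumes "\<alpha> \<in> R"
  obtains "\<alpha> \<in> isotropic" | "\<alpha> \<in> anisotropic"
  using assms by (auto simp: isotropic_def anisotropic_def)

lemma reflection_root:
  "\<gamma> \<in> anisotropic \<Longrightarrow> \<beta> \<in> R \<Longrightarrow> reflection scale form \<gamma> \<beta> \<in> R"
  using GR2 by (auto simp: GR2_def anisotropic_def)

lemma reflection_isotropic:
  "\<gamma> \<in> anisotropic \<Longrightarrow> \<beta> \<in> isotropic \<Longrightarrow> reflection scale form \<gamma> \<beta> \<in> isotropic"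
  using reflection_root[of \<gamma> \<beta>] by (auto simp: isotropic_def anisotropic_def form_reflection)

text \<open>Pairing with \<open>\<gamma>\<close> divided by \<open>form \<gamma> \<gamma>\<close> is
  1 on \<open>\<gamma>\<close>, hence integral on \<open>group_closure {\<gamma>}\<close>; on
  \<open>\<beta> - reflection scale form \<gamma> \<beta>\<close> it gives the Cartan
  integer.\<close>

lemma coroot_integral:
  assumes \<gamma>: "\<gamma> \<in> anisotropic" and \<beta>: "\<beta> \<in> R"
  shows "2 * form \<gamma> \<beta> / form \<gamma> \<gamma> \<in> \<int>"
proof -
  have "\<beta> - reflection scale form \<gamma> \<beta> \<in> group_closure {\<gamma>}"
    using GR2 \<gamma> \<beta> by (auto simp: GR2_def anisotropic_def)
  then have "form \<gamma> (\<beta> - reflection scale form \<gamma> \<beta>) / form \<gamma> \<gamma> \<in> \<int>"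
    by (rule group_closure_group_hom[rotated 4])
      (use \<gamma> in \<open>auto simp: form_simps diff_divide_distrib anisotropic_def\<close>)
  then show ?thesis
    using \<gamma> by (simp add: reflection_def form_simps anisotropic_def)
qed

text \<open>The sign is kept as an integer \<open>\<epsilon>\<close> so that both cases of (WGR3)
  are computed at once.\<close>

lemma isotropic_string:
  assumes "\<alpha> \<in> isotropic" "\<beta> \<in> R" "form \<alpha> \<beta> \<noteq> 0"
  obtains \<epsilon> :: int where "\<epsilon> = 1 \<or> \<epsilon> = -1" "\<beta> + scale (of_int \<epsilon>) \<alpha> \<in> R"
proof -
  obtain r where r: "r \<in> R \<rightarrow> R" "\<forall>\<beta>\<in>R. form \<alpha> \<beta> \<noteq> 0 \<longrightarrow> r \<beta> \<in> {\<beta> + \<alpha>, \<beta> - \<alpha>}"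
    using WGR3 assms(1) unfolding WGR3_def isotropic_def by blast
  then have "\<beta> + \<alpha> \<in> R \<or> \<beta> - \<alpha> \<in> R"
    using assms(2,3) by (metis PiE insertE singletonD)
  then show thesis
    using that[of 1] that[of "-1"] by (auto simp: scale_minus_left)
qed

text \<open>Passing from \<open>\<gamma>\<close> to \<open>\<gamma> \<plusminus> \<alpha>\<close> replaces the Cartan integer \<open>k\<close> by \<open>k / (1 \<plusminus> k)\<close>.\<close>

lemma coroot_isotropic:
  assumes \<gamma>: "\<gamma> \<in> anisotropic" and \<alpha>: "\<alpha> \<in> isotropic"
  shows "2 * form \<gamma> \<alpha> / form \<gamma> \<gamma> \<in> {0, 1, -1, 2, -2}"
proof (cases "form \<gamma> \<alpha> = 0")
  case False
  have n: "form \<gamma> \<gamma> \<noteq> 0" and R: "\<gamma> \<in> R" "\<alpha> \<in> R" and a: "form \<alpha> \<alpha> = 0"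
    using \<gamma> \<alpha> by (auto simp: anisotropic_def isotropic_def)
  obtain k :: int where k: "2 * form \<gamma> \<alpha> / form \<gamma> \<gamma> = of_int k"
    using coroot_integral[OF \<gamma> R(2)] by (auto elim: Ints_cases)
  then have k': "2 * form \<gamma> \<alpha> = of_int k * form \<gamma> \<gamma>"
    using n by (simp add: field_simps)
  obtain \<epsilon> :: int where \<epsilon>: "\<epsilon> = 1 \<or> \<epsilon> = -1" "\<gamma> + scale (of_int \<epsilon>) \<alpha> \<in> R"
    using isotropic_string[OF \<alpha> R(1)] False by (auto simp: form_sym)
  define \<delta> where "\<delta> = \<gamma> + scale (of_int \<epsilon>) \<alpha>"
  have "form \<delta> \<delta> = form \<gamma> \<gamma> + of_int \<epsilon> * (2 * form \<gamma> \<alpha>)"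
    by (simp add: \<delta>_def form_simps a form_sym[of \<alpha> \<gamma>])
  then have \<delta>\<delta>: "form \<delta> \<delta> = of_int (1 + \<epsilon> * k) * form \<gamma> \<gamma>"
    by (simp add: k' algebra_simps)
  have \<delta>\<alpha>: "form \<delta> \<alpha> = form \<gamma> \<alpha>"
    by (simp add: \<delta>_def form_simps a)
  \<comment> \<open>The value 0 is the case of isotropic \<open>\<delta>\<close>. Otherwise
    integrality for \<open>\<delta>\<close> makes \<open>1 + \<epsilon> * k\<close> a divisor of
    \<open>k\<close>, hence of 1.\<close>
  have "1 + \<epsilon> * k \<in> {0, 1, -1}"
  proof (cases "1 + \<epsilon> * k = 0")
    case nz: False
    then have "form \<delta> \<delta> \<noteq> 0"
      unfolding \<delta>\<delta> using n by (simp only: mult_eq_0_iff of_int_eq_0_iff) simp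
    then have "\<delta> \<in> anisotropic"
      using \<epsilon>(2) by (simp add: anisotropic_def \<delta>_def)
    then obtain m :: int where "2 * form \<delta> \<alpha> / form \<delta> \<delta> = of_int m"
      using coroot_integral[OF _ R(2)] by (auto elim: Ints_cases)
    then have "of_int k * form \<gamma> \<gamma> = of_int m * form \<delta> \<delta>"
      using \<open>form \<delta> \<delta> \<noteq> 0\<close> by (simp add: \<delta>\<alpha> k' field_simps)
    then have "(of_int k :: complex) = of_int (m * (1 + \<epsilon> * k))"
      unfolding \<delta>\<delta> using n by simp
    then have "k = m * (1 + \<epsilon> * k)"
      by (simp only: of_int_eq_iff)
    then have "(1 + \<epsilon> * k) dvd \<epsilon> * k"
      by (metis dvd_mult dvd_triv_right)
    then have "(1 + \<epsilon> * k) dvd 1"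
      using dvd_diff[of "1 + \<epsilon> * k" "1 + \<epsilon> * k" "\<epsilon> * k"] by simp
    then show ?thesis
      unfolding zdvd1_eq by (simp only: insert_iff) linarith
  qed simp
  then have "k \<in> {0, 1, -1, 2, -2}"
    using \<epsilon>(1) by auto
  then show ?thesis
    unfolding k by auto
qed simp

text \<open>The reflection in \<open>\<gamma>\<close> moves \<open>\<alpha>\<close> to another
  isotropic root, and the difference of the two is a nonzero multiple of
  \<open>\<gamma>\<close>.\<close>

lemma anisotropic_in_span_isotropic:
  assumes "\<gamma> \<in> anisotropic" "\<alpha> \<in> isotropic" "form \<gamma> \<alpha> \<noteq> 0"
  shows "\<gamma> \<in> span isotropic"
proof -
  have n: "form \<gamma> \<gamma> \<noteq> 0"
    using assms(1) by (simp add: anisotropic_def)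
  have "scale (form \<gamma> \<gamma> / (2 * form \<gamma> \<alpha>)) (\<alpha> - reflection scale form \<gamma> \<alpha>) \<in> span isotropic"
    using assms(2) reflection_isotropic[OF assms(1,2)]
    by (intro span_scale span_diff span_base)
  then show ?thesis
    using n assms(3) by (simp add: reflection_def)
qed

text \<open>An anisotropic root either pairs nontrivially with some isotropic root and so lies in
  the span, or is orthogonal to the whole span. Either way \<open>v\<close> is orthogonal to it,
  hence to all of \<open>R\<close>.\<close>

lemma span_isotropic_nondegenerate:
  assumes v: "v \<in> span isotropic" and orth: "\<And>\<alpha>. \<alpha> \<in> isotropic \<Longrightarrow> form v \<alpha> = 0"
  shows "v = 0"
proof (rule eq_zero_if_orthogonal)
  fix \<beta> assume "\<beta> \<in> R"
  then show "form v \<beta> = 0"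
  proof (cases rule: root_cases)
    case 1
    then show ?thesis
      by (rule orth)
  next
    case 2
    show ?thesis
    proof (cases "\<exists>\<alpha>\<in>isotropic. form \<beta> \<alpha> \<noteq> 0")
      case True
      then have "\<beta> \<in> span isotropic"
        using anisotropic_in_span_isotropic[OF 2] by blast
      then show ?thesis
        using orthogonal_span[of isotropic v \<beta>] orth by blast
    next
      case False
      then have "form \<beta> v = 0"
        using orthogonal_span[OF _ v] by blast
      then show ?thesis
        by (simp add: form_sym)
    qed
  qed
qed

text \<open>\<open>2 * c\<close> and \<open>2 / c\<close> are both Cartan integers, and their
  product is 4.\<close>

lemma proportional_roots:
  assumes \<gamma>: "\<gamma> \<in> anisotropic" and \<gamma>': "\<gamma>' \<in> anisotropic" and c: "\<gamma>' = scale c \<gamma>"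
  shows "c \<in> {1, -1, 2, -2, 1/2, -1/2}"
proof -
  have n: "form \<gamma> \<gamma> \<noteq> 0" and R: "\<gamma> \<in> R" "\<gamma>' \<in> R"
    using \<gamma> \<gamma>' by (auto simp: anisotropic_def)
  have c0: "c \<noteq> 0"
    using c root_nonzero[OF R(2)] by auto
  obtain i :: int where i: "2 * c = of_int i"
    using coroot_integral[OF \<gamma> R(2)] n by (auto simp: c form_simps elim: Ints_cases)
  obtain j :: int where j: "2 / c = of_int j"
    using coroot_integral[OF \<gamma>' R(1)] n c0
    by (auto simp: c form_simps elim: Ints_cases)
  have "(2 * c) * (2 / c) = 4"
    using c0 by simp
  then have "(of_int (i * j) :: complex) = of_int 4"
    by (simp add: i j)
  then have "i * j = 4"
    by (simp only: of_int_eq_iff)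
  from int_dvd_4_cases[OF this] have "2 * c \<in> {1, -1, 2, -2, 4, -4}"
    unfolding i by auto
  then have "(2 * c) / 2 \<in> (\<lambda>x. x / 2) ` {1, -1, 2, -2, 4, -4}"
    by (rule imageI)
  then show ?thesis
    by auto
qed

section \<open>Finiteness of the isotropic roots and of the anisotropic roots linked to them\<close>

lemma finite_anisotropic_linked:
  "finite {\<gamma> \<in> anisotropic. \<exists>\<alpha>\<in>isotropic. form \<gamma> \<alpha> \<noteq> 0}" (is "finite ?N")
proof (rule ccontr)
  assume inf: "infinite ?N"
  obtain E where E: "E \<subseteq> isotropic" "independent E" "isotropic \<subseteq> span E"
    using maximal_independent_subset[of isotropic] by blast
  \<comment> \<open>The pattern of Cartan integers on the basis \<open>E\<close>;
    \<open>restrict\<close> places it in a finite function space, so an infinite \<open>?N\<close>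
    would have an infinite fibre.\<close>
  define \<kappa> where "\<kappa> \<gamma> = restrict (\<lambda>\<alpha>. 2 * form \<gamma> \<alpha> / form \<gamma> \<gamma>) E" for \<gamma>
  have "\<kappa> ` ?N \<subseteq> E \<rightarrow>\<^sub>E {0, 1, -1, 2, -2}"
    unfolding \<kappa>_def using coroot_isotropic E(1) by fastforce
  then have "finite (\<kappa> ` ?N)"
    by (rule finite_subset) (use finiteI_independent[OF E(2)] in \<open>auto intro: finite_PiE\<close>)
  from pigeonhole_infinite[OF inf this] obtain \<gamma>
    where \<gamma>: "\<gamma> \<in> ?N" and fibre: "infinite {\<gamma>' \<in> ?N. \<kappa> \<gamma>' = \<kappa> \<gamma>}"
    by blast
  have "{\<gamma>' \<in> ?N. \<kappa> \<gamma>' = \<kappa> \<gamma>} \<subseteq> (\<lambda>c. scale c \<gamma>) ` {1, -1, 2, -2, 1/2, -1/2}"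
  proof
    fix \<gamma>' assume \<gamma>': "\<gamma>' \<in> {\<gamma>' \<in> ?N. \<kappa> \<gamma>' = \<kappa> \<gamma>}"
    \<comment> \<open>The difference of two normalized roots whose pairings with \<open>E\<close>
      are the patterns. Equal patterns make \<open>v\<close> orthogonal to \<open>E\<close>, hence
      zero, so the two roots are proportional.\<close>
    define v where "v = scale (2 / form \<gamma>' \<gamma>') \<gamma>' - scale (2 / form \<gamma> \<gamma>) \<gamma>"
    have "form v \<alpha> = 0" if "\<alpha> \<in> E" for \<alpha>
    proof -
      have "\<kappa> \<gamma>' \<alpha> = \<kappa> \<gamma> \<alpha>"
        using \<gamma>' by simp
      then show ?thesis
        using that by (simp add: v_def \<kappa>_def form_simps)
    qed
    then have "form v \<alpha> = 0" if "\<alpha> \<in> isotropic" for \<alpha>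
      using orthogonal_span[of E v \<alpha>] E(3) that by blast
    moreover have "v \<in> span isotropic"
      unfolding v_def using \<gamma> \<gamma>' anisotropic_in_span_isotropic
      by (intro span_diff span_scale) auto
    ultimately have "v = 0"
      using span_isotropic_nondegenerate by blast
    then have "scale (form \<gamma>' \<gamma>' / 2) (scale (2 / form \<gamma>' \<gamma>') \<gamma>') =
        scale (form \<gamma>' \<gamma>' / 2) (scale (2 / form \<gamma> \<gamma>) \<gamma>)"
      by (simp add: v_def)
    moreover have "form \<gamma>' \<gamma>' \<noteq> 0"
      using \<gamma>' by (auto simp: anisotropic_def)
    ultimately have c: "\<gamma>' = scale (form \<gamma>' \<gamma>' / form \<gamma> \<gamma>) \<gamma>"
      by simp
    then show "\<gamma>' \<in> (\<lambda>c. scale c \<gamma>) ` {1, -1, 2, -2, 1/2, -1/2}"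
      using proportional_roots[OF _ _ c] \<gamma> \<gamma>' by blast
  qed
  from finite_subset[OF this] fibre show False
    by simp
qed

text \<open>By nondegeneracy \<open>\<alpha>\<close> pairs nontrivially with some
  \<open>\<beta>\<close> in a finite basis \<open>E\<close>. The string through
  \<open>\<beta>\<close> then contains a linked anisotropic root, and \<open>\<alpha>\<close> is
  recovered from finite data.\<close>

lemma finite_isotropic: "finite isotropic"
proof -
  let ?N = "{\<gamma> \<in> anisotropic. \<exists>\<alpha>\<in>isotropic. form \<gamma> \<alpha> \<noteq> 0}"
  obtain E where E: "E \<subseteq> isotropic" "independent E" "isotropic \<subseteq> span E"
    using maximal_independent_subset[of isotropic] by blast
  \<comment> \<open>Solves \<open>\<gamma> = \<beta> + scale (of_int \<epsilon>) \<alpha>\<close>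
    for \<open>\<alpha>\<close>, using that \<open>\<epsilon>\<close> is its own inverse.\<close>
  define f where "f = (\<lambda>(\<epsilon> :: int, \<gamma>, \<beta>). scale (of_int \<epsilon>) (\<gamma> - \<beta>))"
  have "isotropic \<subseteq> f ` ({1, -1} \<times> ?N \<times> E)"
  proof
    fix \<alpha> assume \<alpha>: "\<alpha> \<in> isotropic"
    have "\<exists>\<beta>\<in>E. form \<alpha> \<beta> \<noteq> 0"
    proof (rule ccontr)
      assume "\<not> ?thesis"
      then have "form \<alpha> \<beta> = 0" if "\<beta> \<in> isotropic" for \<beta>
        using orthogonal_span[of E \<alpha> \<beta>] E(3) that by blast
      then have "\<alpha> = 0"
        using span_isotropic_nondegenerate[OF span_base[OF \<alpha>]] by blast
      then show False
        using root_nonzero[of \<alpha>] \<alpha> by (simp add: isotropic_def)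
    qed
    then obtain \<beta> where \<beta>: "\<beta> \<in> E" "form \<alpha> \<beta> \<noteq> 0"
      by blast
    then have iso: "\<alpha> \<in> R" "\<beta> \<in> R" "\<beta> \<in> isotropic" "form \<alpha> \<alpha> = 0" "form \<beta> \<beta> = 0"
      using \<alpha> E(1) by (auto simp: isotropic_def)
    obtain \<epsilon> :: int where \<epsilon>: "\<epsilon> = 1 \<or> \<epsilon> = -1" "\<beta> + scale (of_int \<epsilon>) \<alpha> \<in> R"
      using isotropic_string[OF \<alpha> iso(2) \<beta>(2)] by blast
    define \<gamma> where "\<gamma> = \<beta> + scale (of_int \<epsilon>) \<alpha>"
    have "form \<gamma> \<gamma> = 2 * of_int \<epsilon> * form \<alpha> \<beta>"
      by (simp add: \<gamma>_def form_simps iso form_sym[of \<beta> \<alpha>])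
    moreover have "form \<gamma> \<alpha> = form \<alpha> \<beta>"
      by (simp add: \<gamma>_def form_simps iso form_sym[of \<beta> \<alpha>])
    ultimately have "form \<gamma> \<gamma> \<noteq> 0" "form \<gamma> \<alpha> \<noteq> 0" "\<gamma> \<in> R"
      using \<epsilon> \<beta>(2) by (auto simp: \<gamma>_def)
    then have "\<gamma> \<in> ?N"
      using \<alpha> by (auto simp: anisotropic_def)
    moreover have "\<alpha> = f (\<epsilon>, \<gamma>, \<beta>)"
      using \<epsilon>(1) by (auto simp: f_def \<gamma>_def)
    ultimately show "\<alpha> \<in> f ` ({1, -1} \<times> ?N \<times> E)"
      using \<beta>(1) \<epsilon>(1) by blast
  qed
  then show ?thesis
    by (rule finite_subset)
      (use finite_anisotropic_linked finiteI_independent[OF E(2)] in blast)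
qed

text \<open>The span of the isotropic roots cuts \<open>R\<close> into two orthogonal pieces that
  inherit the axioms. The inner piece contains \<open>\<alpha>\<close>, so the outer one is empty;
  by nondegeneracy each root in the span is linked to an isotropic root.\<close>

lemma irreducible_finite:
  assumes irr: "irreducible_roots scale form R" and iso: "\<alpha> \<in> isotropic"
  shows "finite R"
proof -
  let ?V = "span isotropic"
  have lin: "reflection scale form \<gamma> \<beta> \<in> ?V" if "\<gamma> \<in> ?V" "\<beta> \<in> ?V" for \<gamma> \<beta>
    using that unfolding reflection_def by (intro span_diff span_scale)
  have outside: "form \<beta> v = 0" if "\<beta> \<in> R - ?V" "v \<in> ?V" for \<beta> v
  proof (rule orthogonal_span[OF _ that(2)])
    fix \<alpha> assume \<alpha>: "\<alpha> \<in> isotropic"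
    have "\<beta> \<in> anisotropic"
      using that(1) root_cases[of \<beta>] span_base[of \<beta> isotropic] by blast
    then show "form \<beta> \<alpha> = 0"
      using anisotropic_in_span_isotropic[OF _ \<alpha>] that(1) by blast
  qed
  \<comment> \<open>Stability under reflections suffices: a reflection is an involution, so it maps
    the subset onto itself.\<close>
  have GR2_sub: "GR2 scale form S"
    if S: "S \<subseteq> R" "\<And>\<gamma> \<beta>. \<gamma> \<in> S \<Longrightarrow> \<beta> \<in> S \<Longrightarrow> form \<gamma> \<gamma> \<noteq> 0 \<Longrightarrow> reflection scale form \<gamma> \<beta> \<in> S" for S
    unfolding GR2_def
  proof (intro ballI impI conjI)
    fix \<gamma> \<beta> assume "\<gamma> \<in> S" "form \<gamma> \<gamma> \<noteq> 0" "\<beta> \<in> S"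
    then show "\<beta> - reflection scale form \<gamma> \<beta> \<in> group_closure {\<gamma>}"
      using GR2 S(1) unfolding GR2_def by blast
  next
    fix \<gamma> assume \<gamma>: "\<gamma> \<in> S" "form \<gamma> \<gamma> \<noteq> 0"
    show "reflection scale form \<gamma> ` S = S"
    proof (intro subset_antisym subsetI)
      fix \<beta> assume "\<beta> \<in> S"
      then have "reflection scale form \<gamma> \<beta> \<in> S"
        using S(2) \<gamma> by blast
      then show "\<beta> \<in> reflection scale form \<gamma> ` S"
        using reflection_reflection[OF \<gamma>(2), of \<beta>] by force
    qed (use S(2) \<gamma> in blast)
  qed
  have "GR2 scale form (R \<inter> ?V)"
  proof (rule GR2_sub)
    fix \<gamma> \<beta> assume "\<gamma> \<in> R \<inter> ?V" "\<beta> \<in> R \<inter> ?V" "form \<gamma> \<gamma> \<noteq> 0"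
    then show "reflection scale form \<gamma> \<beta> \<in> R \<inter> ?V"
      using reflection_root[of \<gamma> \<beta>] lin[of \<gamma> \<beta>] by (auto simp: anisotropic_def)
  qed simp
  moreover have "GR2 scale form (R - ?V)"
  proof (rule GR2_sub)
    fix \<gamma> \<beta> assume \<gamma>: "\<gamma> \<in> R - ?V" "\<beta> \<in> R - ?V" "form \<gamma> \<gamma> \<noteq> 0"
    \<comment> \<open>The reflected root stays orthogonal to \<open>?V\<close>; lying in
      \<open>?V\<close> as well, it would vanish by nondegeneracy.\<close>
    have "form (reflection scale form \<gamma> \<beta>) v = 0" if "v \<in> ?V" for v
      using outside[OF \<gamma>(1) that] outside[OF \<gamma>(2) that] by (simp add: reflection_def form_simps)
    then have "reflection scale form \<gamma> \<beta> \<notin> ?V"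
      using span_isotropic_nondegenerate[of "reflection scale form \<gamma> \<beta>"] span_base
        root_nonzero[OF reflection_root[of \<gamma> \<beta>]] \<gamma> by (auto simp: anisotropic_def)
    then show "reflection scale form \<gamma> \<beta> \<in> R - ?V"
      using reflection_root[of \<gamma> \<beta>] \<gamma> by (auto simp: anisotropic_def)
  qed simp
  moreover have "WGR3 form (R \<inter> ?V)"
    unfolding WGR3_def
  proof (intro ballI impI)
    fix \<alpha> assume \<alpha>: "\<alpha> \<in> R \<inter> ?V" "form \<alpha> \<alpha> = 0"
    then obtain r where r: "r \<in> R \<rightarrow> R" "r \<alpha> = - \<alpha>" "r (- \<alpha>) = \<alpha>"
      "\<forall>\<beta>\<in>R. \<beta> \<noteq> \<alpha> \<and> \<beta> \<noteq> - \<alpha> \<and> form \<alpha> \<beta> = 0 \<longrightarrow> r \<beta> = \<beta>"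
      "\<forall>\<beta>\<in>R. form \<alpha> \<beta> \<noteq> 0 \<longrightarrow> r \<beta> \<in> {\<beta> + \<alpha>, \<beta> - \<alpha>}"
      using WGR3 unfolding WGR3_def by blast
    have "r \<beta> \<in> R \<inter> ?V" if \<beta>: "\<beta> \<in> R \<inter> ?V" for \<beta>
    proof -
      have "r \<beta> \<in> {- \<alpha>, \<alpha>, \<beta>, \<beta> + \<alpha>, \<beta> - \<alpha>}"
        using r(2-5) \<beta> by (cases "\<beta> = \<alpha> \<or> \<beta> = - \<alpha>"; cases "form \<alpha> \<beta> = 0") auto
      then show ?thesis
        using r(1) \<alpha> \<beta> by (auto intro: span_add span_diff span_neg)
    qed
    then show "\<exists>r\<in>R \<inter> ?V \<rightarrow> R \<inter> ?V. r \<alpha> = - \<alpha> \<and> r (- \<alpha>) = \<alpha> \<and>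
        (\<forall>\<beta>\<in>R \<inter> ?V. \<beta> \<noteq> \<alpha> \<and> \<beta> \<noteq> - \<alpha> \<and> form \<alpha> \<beta> = 0 \<longrightarrow> r \<beta> = \<beta>) \<and>
        (\<forall>\<beta>\<in>R \<inter> ?V. form \<alpha> \<beta> \<noteq> 0 \<longrightarrow> r \<beta> \<in> {\<beta> + \<alpha>, \<beta> - \<alpha>})"
      using r by (intro bexI[of _ r]) auto
  qed
  \<comment> \<open>Vacuous, since all isotropic roots lie in \<open>?V\<close>.\<close>
  moreover have "WGR3 form (R - ?V)"
    unfolding WGR3_def using span_base by (auto simp: isotropic_def)
  moreover have "R \<inter> ?V \<noteq> {}"
    using iso span_base[OF iso] by (auto simp: isotropic_def)
  moreover have "form \<alpha> \<beta> = 0" if "\<alpha> \<in> R \<inter> ?V" "\<beta> \<in> R - ?V" for \<alpha> \<beta>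
    using outside[OF that(2), of \<alpha>] that(1) by (simp add: form_sym)
  moreover have "R = (R \<inter> ?V) \<union> (R - ?V)" "(R \<inter> ?V) \<inter> (R - ?V) = {}"
    by auto
  ultimately have "R - ?V = {}"
    using irr unfolding irreducible_roots_def by blast
  have "R \<subseteq> isotropic \<union> {\<gamma> \<in> anisotropic. \<exists>\<alpha>\<in>isotropic. form \<gamma> \<alpha> \<noteq> 0}"
  proof
    fix \<gamma> assume \<gamma>: "\<gamma> \<in> R"
    then have "\<gamma> \<in> ?V" "\<gamma> \<noteq> 0"
      using \<open>R - ?V = {}\<close> root_nonzero by auto
    then have "\<exists>\<alpha>\<in>isotropic. form \<gamma> \<alpha> \<noteq> 0"
      using span_isotropic_nondegenerate by blast
    then show "\<gamma> \<in> isotropic \<union> {\<gamma> \<in> anisotropic. \<exists>\<alpha>\<in>isotropic. form \<gamma> \<alpha> \<noteq> 0}"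
      using \<gamma> by (auto elim: root_cases)
  qed
  then show ?thesis
    using finite_subset finite_isotropic finite_anisotropic_linked by blast
qed

section \<open>Averaged isotropic roots\<close>

definition iso_coset :: "'v \<Rightarrow> 'v set" where
  "iso_coset \<alpha> = {\<alpha>' \<in> isotropic. \<alpha>' - \<alpha> \<in> span anisotropic}"

text \<open>For isotropic \<open>\<alpha>\<close> this is the component of \<open>\<alpha>\<close>
  orthogonal to the span of the anisotropic roots. A mean is used because nondegeneracy on that span
  is only deduced from it.\<close>

definition average :: "'v \<Rightarrow> 'v" where
  "average \<alpha> = scale (1 / of_nat (card (iso_coset \<alpha>))) (\<Sum>\<alpha>'\<in>iso_coset \<alpha>. \<alpha>')"

lemma finite_iso_coset: "finite (iso_coset \<alpha>)"
  unfolding iso_coset_def using finite_isotropic by simp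

lemma card_iso_coset: "\<alpha> \<in> isotropic \<Longrightarrow> card (iso_coset \<alpha>) \<noteq> 0"
  using finite_iso_coset[of \<alpha>] span_zero by (auto simp: iso_coset_def)

text \<open>The reflection in \<open>\<gamma>\<close> permutes the coset and negates the pairing
  with \<open>\<gamma>\<close>, so the sum of these pairings equals its own negative.\<close>

lemma average_orthogonal:
  assumes \<gamma>: "\<gamma> \<in> anisotropic"
  shows "form \<gamma> (average \<alpha>) = 0"
proof -
  have n: "form \<gamma> \<gamma> \<noteq> 0"
    using \<gamma> by (simp add: anisotropic_def)
  have closed: "reflection scale form \<gamma> \<beta> \<in> iso_coset \<alpha>" if "\<beta> \<in> iso_coset \<alpha>" for \<beta>
  proof -
    have "(\<beta> - \<alpha>) - scale (2 * form \<gamma> \<beta> / form \<gamma> \<gamma>) \<gamma> \<in> span anisotropic"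
      by (rule span_diff[OF _ span_scale[OF span_base[OF \<gamma>]]]) (use that in \<open>simp add: iso_coset_def\<close>)
    then show ?thesis
      using that reflection_isotropic[OF \<gamma>, of \<beta>]
      by (auto simp: iso_coset_def reflection_def algebra_simps)
  qed
  have "(\<Sum>\<beta>\<in>iso_coset \<alpha>. form \<gamma> \<beta>) = (\<Sum>\<beta>\<in>iso_coset \<alpha>. form \<gamma> (reflection scale form \<gamma> \<beta>))"
    by (rule sum.reindex_bij_witness[of _ "reflection scale form \<gamma>" "reflection scale form \<gamma>"])
      (auto simp: closed reflection_reflection[OF n])
  also have "\<dots> = - (\<Sum>\<beta>\<in>iso_coset \<alpha>. form \<gamma> \<beta>)"
    using n by (simp add: reflection_def form_simps flip: sum_negf)
  finally show ?thesis
    by (simp add: average_def form_simps)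
qed

lemma average_orthogonal_span: "u \<in> span anisotropic \<Longrightarrow> form (average \<alpha>) u = 0"
  by (rule orthogonal_span) (simp_all add: average_orthogonal form_sym[of "average \<alpha>"])

lemma average_linked:
  assumes "form v (average \<alpha>) \<noteq> 0"
  obtains \<alpha>' where "\<alpha>' \<in> iso_coset \<alpha>" "form v \<alpha>' \<noteq> 0"
proof -
  have "(\<Sum>\<alpha>'\<in>iso_coset \<alpha>. form v \<alpha>') \<noteq> 0"
    using assms by (simp only: average_def form_scale_right form_sum_right mult_eq_0_iff) simp
  then show thesis
    using that by (meson sum.neutral)
qed

lemma diff_average:
  assumes "\<alpha> \<in> isotropic"
  shows "\<alpha> - average \<alpha> \<in> span anisotropic"
proof -
  let ?n = "of_nat (card (iso_coset \<alpha>)) :: complex"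
  have n: "?n \<noteq> 0"
    using card_iso_coset[OF assms] by simp
  have "scale (1 / ?n) (\<Sum>\<alpha>'\<in>iso_coset \<alpha>. \<alpha>' - \<alpha>) \<in> span anisotropic"
    by (intro span_scale span_sum) (simp add: iso_coset_def)
  moreover have "scale (1 / ?n) (\<Sum>\<alpha>'\<in>iso_coset \<alpha>. \<alpha>' - \<alpha>) = average \<alpha> - \<alpha>"
    using n by (simp add: sum_subtractf sum_constant_scale average_def scale_right_diff_distrib)
  ultimately show ?thesis
    using span_neg by fastforce
qed

text \<open>An isotropic \<open>\<beta>\<close> is the sum of
  \<open>\<beta> - average \<beta>\<close>, which lies in the span, and
  \<open>average \<beta>\<close>, which is orthogonal to it; \<open>u\<close> is orthogonal to
  both.\<close>

lemma span_anisotropic_nondegenerate: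
  assumes u: "u \<in> span anisotropic" and orth: "\<And>\<gamma>. \<gamma> \<in> anisotropic \<Longrightarrow> form u \<gamma> = 0"
  shows "u = 0"
proof (rule eq_zero_if_orthogonal)
  fix \<beta> assume "\<beta> \<in> R"
  then show "form u \<beta> = 0"
  proof (cases rule: root_cases)
    case 1
    have "form u (\<beta> - average \<beta>) = 0"
      using orthogonal_span[OF orth diff_average[OF 1]] by blast
    moreover have "form u (average \<beta>) = 0"
      using average_orthogonal_span[OF u] by (simp add: form_sym)
    ultimately show ?thesis
      by (simp add: form_simps)
  qed (rule orth)
qed

lemma linked_averages:
  assumes \<alpha>: "\<alpha> \<in> isotropic" and \<beta>: "\<beta> \<in> isotropic" and ne: "form (average \<alpha>) \<beta> \<noteq> 0"
  obtains \<epsilon> :: int where "form (average \<alpha>) \<beta> = of_int \<epsilon> * form (average \<alpha>) (average \<alpha>)"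
proof -
  \<comment> \<open>Replacing \<open>\<beta>\<close> by its average changes it by an element of the
    anisotropic span, to which \<open>average \<alpha>\<close> is orthogonal.\<close>
  have \<beta>_avg: "form (average \<alpha>) \<beta> = form (average \<alpha>) (average \<beta>)"
    using average_orthogonal_span[OF diff_average[OF \<beta>], of \<alpha>] by (simp add: form_simps)
  then obtain \<beta>' where \<beta>': "\<beta>' \<in> iso_coset \<beta>" "form \<beta>' (average \<alpha>) \<noteq> 0"
    using average_linked[of "average \<alpha>" \<beta>] ne by (metis form_sym)
  then obtain \<alpha>' where \<alpha>': "\<alpha>' \<in> iso_coset \<alpha>" "form \<beta>' \<alpha>' \<noteq> 0"
    using average_linked by blast
  then have ne': "form \<alpha>' \<beta>' \<noteq> 0"
    by (metis form_sym)
  from \<alpha>' \<beta>' have iso: "\<alpha>' \<in> isotropic" "\<beta>' \<in> isotropic"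
    and cosets: "\<alpha>' - \<alpha> \<in> span anisotropic" "\<beta>' - \<beta> \<in> span anisotropic"
    by (auto simp: iso_coset_def)
  have "\<beta>' \<in> R"
    using iso(2) by (simp add: isotropic_def)
  obtain \<epsilon> :: int where \<epsilon>: "\<epsilon> = 1 \<or> \<epsilon> = -1" "\<beta>' + scale (of_int \<epsilon>) \<alpha>' \<in> R"
    using isotropic_string[OF iso(1) \<open>\<beta>' \<in> R\<close> ne'] by blast
  define \<gamma> where "\<gamma> = \<beta>' + scale (of_int \<epsilon>) \<alpha>'"
  have "form \<gamma> \<gamma> = 2 * of_int \<epsilon> * form \<alpha>' \<beta>'"
    using iso by (simp add: \<gamma>_def form_simps isotropic_def form_sym[of \<beta>' \<alpha>'])
  then have "form \<gamma> \<gamma> \<noteq> 0"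
    using \<epsilon>(1) ne' by auto
  then have "\<gamma> \<in> anisotropic"
    using \<epsilon>(2) by (simp add: anisotropic_def \<gamma>_def)
  \<comment> \<open>\<open>u\<close> is congruent to the anisotropic root \<open>\<gamma>\<close>
    modulo the anisotropic span, so it lies in that span; being also orthogonal to it,
    \<open>u\<close> is zero.\<close>
  define u where "u = average \<beta> + scale (of_int \<epsilon>) (average \<alpha>)"
  have "\<gamma> - (\<beta>' - \<beta>) - (\<beta> - average \<beta>)
      - scale (of_int \<epsilon>) ((\<alpha>' - \<alpha>) + (\<alpha> - average \<alpha>)) \<in> span anisotropic"
    by (rule span_diff[OF span_diff[OF span_diff[OF span_base[OF \<open>\<gamma> \<in> anisotropic\<close>] cosets(2)]
          diff_average[OF \<beta>]] span_scale[OF span_add[OF cosets(1) diff_average[OF \<alpha>]]]])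
  moreover have "\<gamma> - (\<beta>' - \<beta>) - (\<beta> - average \<beta>)
      - scale (of_int \<epsilon>) ((\<alpha>' - \<alpha>) + (\<alpha> - average \<alpha>)) = u"
    by (simp add: \<gamma>_def u_def algebra_simps)
  ultimately have "u \<in> span anisotropic"
    by simp
  moreover have "form u \<delta> = 0" if "\<delta> \<in> anisotropic" for \<delta>
    using average_orthogonal_span[OF span_base[OF that]] by (simp add: u_def form_simps)
  ultimately have "u = 0"
    using span_anisotropic_nondegenerate by blast
  then have "average \<beta> = - scale (of_int \<epsilon>) (average \<alpha>)"
    by (simp add: u_def eq_neg_iff_add_eq_0)
  then have "form (average \<alpha>) \<beta> = of_int (- \<epsilon>) * form (average \<alpha>) (average \<alpha>)"
    by (simp add: \<beta>_avg form_simps)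
  then show thesis
    by (rule that)
qed

text \<open>A root not orthogonal to the average must be isotropic, and then
  \<open>linked_averages\<close> makes the pairing a multiple of the zero norm.\<close>

lemma average_zero:
  assumes \<alpha>: "\<alpha> \<in> isotropic" and zero: "form (average \<alpha>) (average \<alpha>) = 0"
  shows "average \<alpha> = 0"
proof (rule eq_zero_if_orthogonal)
  fix \<beta> assume "\<beta> \<in> R"
  then show "form (average \<alpha>) \<beta> = 0"
  proof (cases rule: root_cases)
    case 1
    show ?thesis
    proof (rule ccontr)
      assume "form (average \<alpha>) \<beta> \<noteq> 0"
      then show False
        using linked_averages[OF \<alpha> 1] zero by (metis mult_zero_right)
    qed
  next
    case 2
    then show ?thesis
      using average_orthogonal_span span_base by blast
  qed
qed

lemma GR1: "GR1 scale R"
proof (rule GR1_if_integral_functionals)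
  \<comment> \<open>Where the average has norm zero, division by zero yields the zero functional. It
    is integral, and separation loses nothing because \<open>average_zero\<close> makes that average
    vanish.\<close>
  define W where "W = (\<lambda>\<gamma>. scale (2 / form \<gamma> \<gamma>) \<gamma>) ` anisotropic \<union>
    (\<lambda>\<alpha>. scale (1 / form (average \<alpha>) (average \<alpha>)) (average \<alpha>)) ` isotropic"
  show "finite_dimensional_vector_space scale Basis"
    by unfold_locales
  show "span R = UNIV"
    by (rule span_R)
  show "Vector_Spaces.linear scale (*) f" if "f \<in> form ` W" for f
    using that form_linear by blast
  show "f \<beta> \<in> \<int>" if "f \<in> form ` W" and \<beta>: "\<beta> \<in> R" for f \<beta>
  proof -
    from that consider (anisotropic) \<gamma> where "\<gamma> \<in> anisotropic" "f = form (scale (2 / form \<gamma> \<gamma>) \<gamma>)"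
      | (isotropic) \<alpha> where "\<alpha> \<in> isotropic"
          "f = form (scale (1 / form (average \<alpha>) (average \<alpha>)) (average \<alpha>))"
      by (auto simp: W_def)
    then show ?thesis
    proof cases
      case anisotropic
      then show ?thesis
        using coroot_integral[OF _ \<beta>] by (simp add: form_simps)
    next
      case isotropic
      then have f: "f \<beta> = form (average \<alpha>) \<beta> / form (average \<alpha>) (average \<alpha>)"
        by (simp add: form_simps)
      show ?thesis
      proof (cases "form (average \<alpha>) \<beta> = 0")
        case False
        then have "\<beta> \<notin> anisotropic"
          using average_orthogonal_span span_base by blast
        with \<beta> have "\<beta> \<in> local.isotropic"
          by (auto elim: root_cases)
        then obtain \<epsilon> :: int
          where "form (average \<alpha>) \<beta> = of_int \<epsilon> * form (average \<alpha>) (average \<alpha>)"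
          using linked_averages[OF isotropic(1) _ False] by blast
        then show ?thesis
          by (simp add: f)
      qed (simp add: f)
    qed
  qed
  show "v = 0" if "\<And>f. f \<in> form ` W \<Longrightarrow> f v = 0" for v
  proof -
    have an: "form \<gamma> v = 0" if "\<gamma> \<in> anisotropic" for \<gamma>
    proof -
      have "form (scale (2 / form \<gamma> \<gamma>) \<gamma>) v = 0"
        using that \<open>\<And>f. f \<in> form ` W \<Longrightarrow> f v = 0\<close> by (auto simp: W_def)
      then show ?thesis
        using that by (simp add: form_simps anisotropic_def)
    qed
    have av: "form (average \<alpha>) v = 0" if "\<alpha> \<in> isotropic" for \<alpha>
    proof (cases "form (average \<alpha>) (average \<alpha>) = 0")
      case True
      then show ?thesis
        using average_zero[OF that] by (simp add: form_simps)
    next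
      case False
      have "form (scale (1 / form (average \<alpha>) (average \<alpha>)) (average \<alpha>)) v = 0"
        using that \<open>\<And>f. f \<in> form ` W \<Longrightarrow> f v = 0\<close> by (auto simp: W_def)
      then show ?thesis
        using False by (simp add: form_simps)
    qed
    show "v = 0"
    proof (rule eq_zero_if_orthogonal)
      fix \<beta> assume "\<beta> \<in> R"
      then show "form v \<beta> = 0"
      proof (cases rule: root_cases)
        case 1
        \<comment> \<open>The coroots control the part of \<open>\<beta>\<close> in the anisotropic
          span, and \<open>av\<close> controls the average.\<close>
        have "form v (\<beta> - average \<beta>) = 0"
          by (rule orthogonal_span[OF _ diff_average[OF 1]]) (simp add: form_sym[of v] an)
        then show ?thesis
          using av[OF 1] by (simp add: form_simps form_sym[of v])
      qed (simp add: form_sym[of v] an)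
    qed
  qed
qed

end

theorem theorem2p1:
  fixes scale :: "complex \<Rightarrow> 'v::ab_group_add \<Rightarrow> 'v"
    and Basis :: "'v set"
    and form :: "'v \<Rightarrow> 'v \<Rightarrow> complex"
    and R :: "'v set"
  assumes "symmetric_form_space scale Basis form"
    and "(UNIV :: 'v set) \<noteq> {0}"
    and "nondegenerate form"
    and "module.span scale R = UNIV"
    and "GR0 form R"
    and "GR2 scale form R"
    and "WGR3 form R"
  shows "(irreducible_roots scale form R \<and> (\<exists>\<alpha>\<in>R. form \<alpha> \<alpha> = 0) \<longrightarrow> finite R) \<and>
    WGRS scale form R"
proof -
  interpret symmetric_form_space scale Basis form by fact
  interpret weak_roots scale Basis form R
    by unfold_locales fact+
  have "R \<noteq> {}"
    using assms(2,4) by (auto simp: span_empty)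
  then have "WGRS scale form R"
    unfolding WGRS_def using assms GR1 by blast
  moreover have "finite R" if "irreducible_roots scale form R" "\<exists>\<alpha>\<in>R. form \<alpha> \<alpha> = 0"
    using that irreducible_finite by (auto simp: isotropic_def)
  ultimately show ?thesis
    by blast
qed

end
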